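(* Let $q$ be a continuous complex-valued function on $[0,b]$ and let $f$ be a solution of $f''-q(x)f=0$ on $[0,b]$ with $f(0)=1$ and $f(x)\neq0$ for all $x\in[0,b]$. With the functions $\mathbf{c}_n,\mathbf{s}_n$ and the formal powers $Y^{(n)},\widetilde Y^{(n)}$ defined in the context, the following equalities hold on $[0,b]$: $$\frac{\mathbf{c}_n}{n!}=fY^{(2n-1)},\qquad \frac{\mathbf{s}_n}{n!}=f\left(\widetilde Y^{(2n)}+Y^{(2n-1)}\right)\qquad\text{for any odd } n\in\mathbb{N},$$ and $$\frac{\mathbf{s}_n}{n!}=fY^{(2n-1)},\qquad \frac{\mathbf{c}_n}{n!}=f\left(\widetilde Y^{(2n)}+Y^{(2n-1)}\right)\qquad\text{for any even } n\in\mathbb{N}.$$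
   Context: $\mathbb{N}=\{1,2,\dots\}$. Functions $\varphi_k$: let $X^{(0)}\equiv\widetilde X^{(0)}\equiv1$, $X^{(n)}(x)=n\int_0^x X^{(n-1)}(s)\left(f^2(s)\right)^{(-1)^n}ds$, $\widetilde X^{(n)}(x)=n\int_0^x \widetilde X^{(n-1)}(s)\left(f^2(s)\right)^{(-1)^{n-1}}ds$ for $n\ge1$; $\varphi_k=fX^{(k)}$ for $k$ odd and $\varphi_k=f\widetilde X^{(k)}$ for $k$ even. Functions $\mathbf{c}_m,\mathbf{s}_m$: $\mathbf{c}_0=f$, $\mathbf{s}_0\equiv0$, and for $m\ge1$, $\mathbf{c}_m(x)=\sum_{\text{even }k=0}^m\binom mk x^k\varphi_{m-k}(x)$, $\mathbf{s}_m(x)=\sum_{\text{odd }k=1}^m\binom mk x^k\varphi_{m-k}(x)$. Formal powers (for the equation $y''-q(x)y=2\lambda y'$): $\widetilde Y^{(0)}\equiv Y^{(0)}\equiv1$ and, for $n\ge1$, $\widetilde Y^{(n)}(x)=2\int_0^x f(s)\left(f(s)\widetilde Y^{(n-1)}(s)\right)'ds$ for $n$ odd, $\widetilde Y^{(n)}(x)=\int_0^x \widetilde Y^{(n-1)}(s)\frac{ds}{f^2(s)}$ for $n$ even; $Y^{(n)}(x)=2\int_0^x f(s)\left(f(s)Y^{(n-1)}(s)\right)'ds$ for $n$ even, $Y^{(n)}(x)=\int_0^x Y^{(n-1)}(s)\frac{ds}{f^2(s)}$ for $n$ odd. *)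

theory Defs
  imports "HOL-Analysis.Analysis"
begin

text \<open>
  A classical solution of \<open>f'' - q f = 0\<close> on the interval \<open>[0, b]\<close>. Derivatives are taken within
  the interval, so they are one-sided at the end points.
\<close>
definition is_solution :: "real \<Rightarrow> (real \<Rightarrow> complex) \<Rightarrow> (real \<Rightarrow> complex) \<Rightarrow> bool" where
  "is_solution b q f \<longleftrightarrow>
    (\<exists>f' f''. \<forall>x\<in>{0..b}.
       (f has_vector_derivative f' x) (at x within {0..b}) \<and>
       (f' has_vector_derivative f'' x) (at x within {0..b}) \<and>
       f'' x - q x * f x = 0)"

primrec X :: "(real \<Rightarrow> complex) \<Rightarrow> nat \<Rightarrow> real \<Rightarrow> complex" where
  "X f 0 = (\<lambda>x. 1)"
| "X f (Suc n) = (\<lambda>x. of_nat (Suc n) *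
     integral {0..x} (\<lambda>s. X f n s * ((f s)\<^sup>2) powi ((-1) ^ Suc n)))"

primrec X_tilde :: "(real \<Rightarrow> complex) \<Rightarrow> nat \<Rightarrow> real \<Rightarrow> complex" where
  "X_tilde f 0 = (\<lambda>x. 1)"
| "X_tilde f (Suc n) = (\<lambda>x. of_nat (Suc n) *
     integral {0..x} (\<lambda>s. X_tilde f n s * ((f s)\<^sup>2) powi ((-1) ^ n)))"

definition \<phi> :: "(real \<Rightarrow> complex) \<Rightarrow> nat \<Rightarrow> real \<Rightarrow> complex" where
  "\<phi> f k x = (if odd k then f x * X f k x else f x * X_tilde f k x)"

definition c_fun :: "(real \<Rightarrow> complex) \<Rightarrow> nat \<Rightarrow> real \<Rightarrow> complex" where
  "c_fun f m x = (if m = 0 then f x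
     else (\<Sum>k | k \<le> m \<and> even k. of_nat (m choose k) * of_real x ^ k * \<phi> f (m - k) x))"

definition s_fun :: "(real \<Rightarrow> complex) \<Rightarrow> nat \<Rightarrow> real \<Rightarrow> complex" where
  "s_fun f m x = (if m = 0 then 0
     else (\<Sum>k | k \<le> m \<and> odd k. of_nat (m choose k) * of_real x ^ k * \<phi> f (m - k) x))"

text \<open>
  The formal powers carry the end point \<open>b\<close> as a parameter only because the derivative in the
  integrand is taken within \<open>[0, b]\<close>; on that interval they depend on \<open>f\<close> restricted to it alone.
\<close>
primrec Y_tilde :: "real \<Rightarrow> (real \<Rightarrow> complex) \<Rightarrow> nat \<Rightarrow> real \<Rightarrow> complex" where
  "Y_tilde b f 0 = (\<lambda>x. 1)"
| "Y_tilde b f (Suc n) = (\<lambda>x.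
     if odd (Suc n)
     then 2 * integral {0..x} (\<lambda>s. f s *
            vector_derivative (\<lambda>t. f t * Y_tilde b f n t) (at s within {0..b}))
     else integral {0..x} (\<lambda>s. Y_tilde b f n s / (f s)\<^sup>2))"

primrec Y :: "real \<Rightarrow> (real \<Rightarrow> complex) \<Rightarrow> nat \<Rightarrow> real \<Rightarrow> complex" where
  "Y b f 0 = (\<lambda>x. 1)"
| "Y b f (Suc n) = (\<lambda>x.
     if even (Suc n)
     then 2 * integral {0..x} (\<lambda>s. f s *
            vector_derivative (\<lambda>t. f t * Y b f n t) (at s within {0..b}))
     else integral {0..x} (\<lambda>s. Y b f n s / (f s)\<^sup>2))"

end

theory Submission
  imports Defs
begin

text \<open>
  Dividing everything by \<open>f\<close> turns the claim into one about primitives. Put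
  \<open>p\<^sub>k = \<phi>\<^sub>k / (f k!)\<close>, and let \<open>q\<^sub>k\<close> be the other one of \<open>X\<^sup>(\<^sup>k\<^sup>) / k!\<close> and \<open>X_tilde\<^sup>(\<^sup>k\<^sup>) / k!\<close>. The
  integrals defining \<open>X\<close> and \<open>X_tilde\<close> then say
  \<open>p\<^sub>k' = q\<^sub>k\<^sub>-\<^sub>1 / f\<^sup>2\<close> and \<open>q\<^sub>k' = f\<^sup>2 p\<^sub>k\<^sub>-\<^sub>1\<close>. Let \<open>a\<^sub>m\<close> be the sum of \<open>x\<^sup>k/k! p\<^sub>m\<^sub>-\<^sub>k\<close> over all \<open>k\<close> of one
  parity, \<open>a*\<^sub>m\<close> the sum over the other parity, and \<open>d\<^sub>m\<close> the sum like \<open>a\<^sub>m\<close> with \<open>q\<close> for \<open>p\<close>. Up to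
  \<open>m!\<close> and \<open>f\<close>, the functions \<open>c\<^sub>m\<close> and \<open>s\<^sub>m\<close> are the two sums \<open>a\<^sub>m\<close>, \<open>a*\<^sub>m\<close>.

  Differentiating \<open>x\<^sup>k/k!\<close> flips the parity and lowers the index, so the product rule gives
  \<open>a\<^sub>m\<^sub>+\<^sub>1' = B\<^sub>m / f\<^sup>2\<close> with \<open>B\<^sub>m = f\<^sup>2 a*\<^sub>m + d\<^sub>m\<close>. It also gives \<open>d\<^sub>m' = f\<^sup>2 (a*\<^sub>m)'\<close>, whence
  \<open>B\<^sub>m' = 2 f f' a*\<^sub>m + 2 f\<^sup>2 (a*\<^sub>m)' = 2 f (f a*\<^sub>m)'\<close>. These are exactly the two integrations that
  generate the formal powers, passing from \<open>a*\<^sub>m\<close> to \<open>B\<^sub>m\<close> and on to \<open>a\<^sub>m\<^sub>+\<^sub>1\<close>, with the parity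
  alternating along the way. All these functions vanish at \<open>0\<close> once \<open>m \<ge> 1\<close>, so an induction
  identifies \<open>Y\<^sup>(\<^sup>2\<^sup>n\<^sup>-\<^sup>1\<^sup>)\<close> with the sum over the \<open>k\<close> whose parity is opposite to that of \<open>n\<close>. The
  relations are linear, and the sum over \<open>k\<close> of the parity of \<open>n\<close> minus that over the opposite parity
  starts at \<open>1\<close> for \<open>n = 0\<close>; hence this difference is \<open>Y_tilde\<^sup>(\<^sup>2\<^sup>n\<^sup>)\<close>, which is the second half of the
  claim.
\<close>

section \<open>Convolution with the divided powers of one parity\<close>

text \<open>The offset \<open>e\<close> selects the parity: only the indices \<open>k\<close> with \<open>k + e\<close> even contribute.\<close>

definition parity_conv :: "nat \<Rightarrow> (nat \<Rightarrow> real \<Rightarrow> complex) \<Rightarrow> nat \<Rightarrow> real \<Rightarrow> complex" where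
  "parity_conv e g m x =
     (\<Sum>k\<le>m. if even (k + e) then of_real x ^ k / fact k * g (m - k) x else 0)"

lemma parity_conv_0: "parity_conv e g 0 x = (if even e then g 0 x else 0)"
  by (simp add: parity_conv_def)

lemma parity_conv_add_2: "parity_conv (Suc (Suc e)) g m x = parity_conv e g m x"
  by (simp add: parity_conv_def)

lemma parity_conv_at_0:
  assumes "\<And>k. g (Suc k) 0 = 0"
  shows "parity_conv e g (Suc m) 0 = 0"
  unfolding parity_conv_def
proof (rule sum.neutral, intro ballI)
  fix k
  show "(if even (k + e) then of_real 0 ^ k / fact k * g (Suc m - k) 0 else 0) = 0"
    by (cases k) (simp_all add: assms)
qed

lemma has_vector_derivative_divided_power:
  "((\<lambda>x. of_real x ^ k / fact k :: complex) has_vector_derivative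
     (case k of 0 \<Rightarrow> 0 | Suc j \<Rightarrow> of_real x ^ j / fact j)) (at x within S)"
proof (cases k)
  case (Suc j)
  have "((\<lambda>z::complex. z ^ Suc j / fact (Suc j)) has_field_derivative
          of_nat (Suc j) * of_real x ^ j / fact (Suc j)) (at (of_real x))"
    using DERIV_cdivide[OF DERIV_power[OF DERIV_ident], where n1 = "Suc j" and c = "fact (Suc j)"]
    by (simp del: of_nat_Suc power_Suc fact_Suc)
  then have "((\<lambda>z::complex. z ^ Suc j / fact (Suc j)) has_field_derivative of_real x ^ j / fact j)
          (at (of_real x))"
    by (simp del: of_nat_Suc power_Suc)
  then show ?thesis
    using has_vector_derivative_real_field Suc
      has_vector_derivative_at_within by fastforce
qed (simp add: has_vector_derivative_const)

text \<open>
  In the product rule the factor \<open>x\<^sup>k/k!\<close> contributes the same convolution for the other parity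
  (reindex by \<open>k + 1\<close>), and the factors \<open>g\<close> contribute the convolution of \<open>h\<close> with the parity kept.
\<close>

lemma has_vector_derivative_parity_conv:
  assumes g0: "(g 0 has_vector_derivative 0) (at x within S)"
    and g: "\<And>k. (g (Suc k) has_vector_derivative w * h k x) (at x within S)"
  shows "(parity_conv e g (Suc m) has_vector_derivative
           parity_conv (Suc e) g m x + w * parity_conv e h m x) (at x within S)"
proof -
  define D where "D k = (case k of 0 \<Rightarrow> 0 | Suc j \<Rightarrow> complex_of_real x ^ j / fact j)" for k
  define G where "G k = (case k of 0 \<Rightarrow> 0 | Suc j \<Rightarrow> w * h j x)" for k
  have G: "(g k has_vector_derivative G k) (at x within S)" for k
    using g0 g by (cases k) (auto simp: G_def)
  have D: "((\<lambda>x. of_real x ^ k / fact k) has_vector_derivative D k) (at x within S)" for k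
    unfolding D_def by (rule has_vector_derivative_divided_power)
  have "((\<lambda>x. if even (k + e) then of_real x ^ k / fact k * g (Suc m - k) x else 0)
          has_vector_derivative
         (if even (k + e) then D k * g (Suc m - k) x else 0) +
         (if even (k + e) then of_real x ^ k / fact k * G (Suc m - k) else 0)) (at x within S)"
    for k
    using has_vector_derivative_mult[OF D[of k] G[of "Suc m - k"]]
    by (cases "even (k + e)") (simp_all add: add.commute has_vector_derivative_const)
  then have "(parity_conv e g (Suc m) has_vector_derivative
      (\<Sum>k\<le>Suc m. (if even (k + e) then D k * g (Suc m - k) x else 0) +
         (if even (k + e) then of_real x ^ k / fact k * G (Suc m - k) else 0))) (at x within S)"
    unfolding parity_conv_def[abs_def] by (intro has_vector_derivative_sum)
  moreover have "(\<Sum>k\<le>Suc m. if even (k + e) then D k * g (Suc m - k) x else 0)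
      = parity_conv (Suc e) g m x"
    unfolding parity_conv_def sum.atMost_Suc_shift by (auto simp: D_def intro!: sum.cong)
  moreover have "(\<Sum>k\<le>Suc m. if even (k + e) then of_real x ^ k / fact k * G (Suc m - k) else 0)
      = w * parity_conv e h m x"
    unfolding parity_conv_def sum.atMost_Suc
    by (auto simp: G_def sum_distrib_left Suc_diff_le intro!: sum.cong split: if_splits)
  ultimately show ?thesis
    by (simp only: sum.distrib)
qed

section \<open>The recursive integrals as a system of derivatives\<close>

text \<open>
  \<open>normalized_phi\<close> is \<open>\<phi>\<^sub>k / (f k!)\<close>; its companion takes the opposite choice between \<open>X\<close> and
  \<open>X_tilde\<close>, which makes the pair closed under differentiation up to the weights \<open>f\<^sup>2\<close> and \<open>1/f\<^sup>2\<close>.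
\<close>

definition normalized_phi :: "(real \<Rightarrow> complex) \<Rightarrow> nat \<Rightarrow> real \<Rightarrow> complex" where
  "normalized_phi f k x = (if odd k then X f k x else X_tilde f k x) / fact k"

definition companion_phi :: "(real \<Rightarrow> complex) \<Rightarrow> nat \<Rightarrow> real \<Rightarrow> complex" where
  "companion_phi f k x = (if odd k then X_tilde f k x else X f k x) / fact k"

lemma phi_eq_normalized_phi: "\<phi> f k x = fact k * (f x * normalized_phi f k x)"
  by (simp add: \<phi>_def normalized_phi_def)

lemma c_fun_eq_parity_conv:
  "c_fun f m x / fact m = f x * parity_conv 0 (normalized_phi f) m x"
proof (cases "m = 0")
  case True
  then show ?thesis by (simp add: c_fun_def parity_conv_0 normalized_phi_def)
next
  case False
  have "c_fun f m x / fact m =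
      (\<Sum>k | k \<le> m \<and> even k. f x * (of_real x ^ k / fact k * normalized_phi f (m - k) x))"
    using False by (auto simp: c_fun_def sum_divide_distrib phi_eq_normalized_phi binomial_fact
        intro!: sum.cong)
  also have "\<dots> = (\<Sum>k\<le>m. if even k
      then f x * (of_real x ^ k / fact k * normalized_phi f (m - k) x) else 0)"
    by (intro sum.mono_neutral_cong_left) auto
  finally show ?thesis
    by (auto simp: parity_conv_def sum_distrib_left intro!: sum.cong)
qed

lemma s_fun_eq_parity_conv:
  "s_fun f m x / fact m = f x * parity_conv 1 (normalized_phi f) m x"
proof (cases "m = 0")
  case True
  then show ?thesis by (simp add: s_fun_def parity_conv_0)
next
  case False
  have "s_fun f m x / fact m =
      (\<Sum>k | k \<le> m \<and> odd k. f x * (of_real x ^ k / fact k * normalized_phi f (m - k) x))"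
    using False by (auto simp: s_fun_def sum_divide_distrib phi_eq_normalized_phi binomial_fact
        intro!: sum.cong)
  also have "\<dots> = (\<Sum>k\<le>m. if odd k
      then f x * (of_real x ^ k / fact k * normalized_phi f (m - k) x) else 0)"
    by (intro sum.mono_neutral_cong_left) auto
  finally show ?thesis
    by (auto simp: parity_conv_def sum_distrib_left intro!: sum.cong)
qed

lemma normalized_phi_at_0: "normalized_phi f (Suc k) 0 = 0"
  and companion_phi_at_0: "companion_phi f (Suc k) 0 = 0"
  by (simp_all add: normalized_phi_def companion_phi_def)

locale nonvanishing_differentiable =
  fixes b :: real and f f' :: "real \<Rightarrow> complex"
  assumes b_pos: "b > 0"
    and f_deriv: "x \<in> {0..b} \<Longrightarrow> (f has_vector_derivative f' x) (at x within {0..b})"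
    and f_nonzero: "x \<in> {0..b} \<Longrightarrow> f x \<noteq> 0"
    and f_0: "f 0 = 1"
begin

lemma continuous_f: "continuous_on {0..b} f"
  using f_deriv by (meson continuous_on_vector_derivative)

lemma continuous_weight: "continuous_on {0..b} (\<lambda>s. ((f s)\<^sup>2) powi ((-1) ^ n))"
  using f_nonzero
  by (cases "even n") (auto simp: power_int_minus intro!: continuous_intros continuous_f)

lemma continuous_on_X: "continuous_on {0..b} (X f n)"
  and continuous_on_X_tilde: "continuous_on {0..b} (X_tilde f n)"
proof (induction n)
  case (Suc n)
  show "continuous_on {0..b} (X f (Suc n))"
    unfolding X.simps
    by (intro continuous_on_mult continuous_on_const indefinite_integral_continuous_1
        integrable_continuous_real Suc continuous_weight)
  show "continuous_on {0..b} (X_tilde f (Suc n))"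
    unfolding X_tilde.simps
    by (intro continuous_on_mult continuous_on_const indefinite_integral_continuous_1
        integrable_continuous_real Suc continuous_weight)
qed (simp_all add: continuous_on_const)

lemma X_Suc_deriv:
  assumes "x \<in> {0..b}"
  shows "(X f (Suc n) has_vector_derivative
           of_nat (Suc n) * (X f n x * ((f x)\<^sup>2) powi ((-1) ^ Suc n))) (at x within {0..b})"
  unfolding X.simps
  by (intro has_vector_derivative_mult_right integral_has_vector_derivative assms
      continuous_on_mult continuous_on_X continuous_weight)

lemma X_tilde_Suc_deriv:
  assumes "x \<in> {0..b}"
  shows "(X_tilde f (Suc n) has_vector_derivative
           of_nat (Suc n) * (X_tilde f n x * ((f x)\<^sup>2) powi ((-1) ^ n))) (at x within {0..b})"
  unfolding X_tilde.simps
  by (intro has_vector_derivative_mult_right integral_has_vector_derivative assms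
      continuous_on_mult continuous_on_X_tilde continuous_weight)

lemma normalized_phi_Suc_deriv:
  assumes "x \<in> {0..b}"
  shows "(normalized_phi f (Suc k) has_vector_derivative
           1 / (f x)\<^sup>2 * companion_phi f k x) (at x within {0..b})"
proof (cases "even k")
  case True
  then show ?thesis
    using has_vector_derivative_divide[OF X_Suc_deriv[OF assms, of k], of "fact (Suc k)"]
    unfolding normalized_phi_def[abs_def] companion_phi_def
    by (simp add: power_int_minus divide_simps del: of_nat_Suc X.simps)
next
  case False
  then show ?thesis
    using has_vector_derivative_divide[OF X_tilde_Suc_deriv[OF assms, of k], of "fact (Suc k)"]
    unfolding normalized_phi_def[abs_def] companion_phi_def
    by (simp add: power_int_minus divide_simps del: of_nat_Suc X_tilde.simps)
qed

lemma companion_phi_Suc_deriv: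
  assumes "x \<in> {0..b}"
  shows "(companion_phi f (Suc k) has_vector_derivative
           (f x)\<^sup>2 * normalized_phi f k x) (at x within {0..b})"
proof (cases "even k")
  case True
  then show ?thesis
    using has_vector_derivative_divide[OF X_tilde_Suc_deriv[OF assms, of k], of "fact (Suc k)"]
    unfolding normalized_phi_def companion_phi_def[abs_def]
    by (simp add: mult.commute del: of_nat_Suc X_tilde.simps)
next
  case False
  then show ?thesis
    using has_vector_derivative_divide[OF X_Suc_deriv[OF assms, of k], of "fact (Suc k)"]
    unfolding normalized_phi_def companion_phi_def[abs_def]
    by (simp add: mult.commute del: of_nat_Suc X.simps)
qed

lemma normalized_phi_0_deriv: "(normalized_phi f 0 has_vector_derivative 0) (at x within S)"
  and companion_phi_0_deriv: "(companion_phi f 0 has_vector_derivative 0) (at x within S)"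
  by (simp_all add: normalized_phi_def[abs_def] companion_phi_def[abs_def])

section \<open>Half-steps between consecutive convolutions\<close>

abbreviation a :: "nat \<Rightarrow> nat \<Rightarrow> real \<Rightarrow> complex" where
  "a e m \<equiv> parity_conv e (normalized_phi f) m"

text \<open>The intermediate function \<open>f\<^sup>2 (a e (m + 1))'\<close>, through which a convolution determines the next.\<close>

definition B :: "nat \<Rightarrow> nat \<Rightarrow> real \<Rightarrow> complex" where
  "B e m x = (f x)\<^sup>2 * a (Suc e) m x + parity_conv e (companion_phi f) m x"

lemma a_Suc_deriv:
  assumes x: "x \<in> {0..b}"
  shows "(a e (Suc m) has_vector_derivative B e m x / (f x)\<^sup>2) (at x within {0..b})"
proof -
  have "B e m x / (f x)\<^sup>2 = a (Suc e) m x + 1 / (f x)\<^sup>2 * parity_conv e (companion_phi f) m x"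
    using f_nonzero[OF x] by (simp add: B_def field_simps)
  then show ?thesis
    using has_vector_derivative_parity_conv[where g = "normalized_phi f" and h = "companion_phi f",
        OF normalized_phi_0_deriv normalized_phi_Suc_deriv[OF x]] by simp
qed

text \<open>
  Both derivatives consist of the same two convolutions of index \<open>m - 1\<close>: the weights \<open>f\<^sup>2\<close> and
  \<open>1/f\<^sup>2\<close> are inverse to each other, and flipping the parity twice restores it. In the derivative of
  \<open>B\<close> this doubles the term \<open>f\<^sup>2 D\<close>, which completes \<open>2 f f' a\<close> to \<open>2 f (f a)'\<close>.
\<close>

lemma companion_conv_deriv:
  assumes x: "x \<in> {0..b}"
  obtains D where "(a (Suc e) m has_vector_derivative D) (at x within {0..b})"
    and "(parity_conv e (companion_phi f) m has_vector_derivative (f x)\<^sup>2 * D) (at x within {0..b})"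
proof (cases m)
  case 0
  have "(a (Suc e) 0 has_vector_derivative 0) (at x within {0..b})"
    and "(parity_conv e (companion_phi f) 0 has_vector_derivative (f x)\<^sup>2 * 0) (at x within {0..b})"
    using normalized_phi_0_deriv companion_phi_0_deriv
    by (cases "even e"; simp add: parity_conv_0[abs_def])+
  then show thesis using that 0 by blast
next
  case (Suc j)
  have "(parity_conv e (companion_phi f) (Suc j) has_vector_derivative
      parity_conv (Suc e) (companion_phi f) j x + (f x)\<^sup>2 * a e j x) (at x within {0..b})"
    by (rule has_vector_derivative_parity_conv[where g = "companion_phi f"
        and h = "normalized_phi f", OF companion_phi_0_deriv companion_phi_Suc_deriv[OF x]])
  moreover have "parity_conv (Suc e) (companion_phi f) j x + (f x)\<^sup>2 * a e j x
      = (f x)\<^sup>2 * (B (Suc e) j x / (f x)\<^sup>2)"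
    using f_nonzero[OF x] by (simp add: B_def parity_conv_add_2)
  ultimately show thesis
    using that[OF a_Suc_deriv[OF x, of "Suc e" j, folded Suc]] Suc by simp
qed

lemma B_deriv:
  assumes x: "x \<in> {0..b}"
  obtains D where "((\<lambda>t. f t * a (Suc e) m t) has_vector_derivative D) (at x within {0..b})"
    and "(B e m has_vector_derivative 2 * (f x * D)) (at x within {0..b})"
proof -
  obtain D where D: "(a (Suc e) m has_vector_derivative D) (at x within {0..b})"
      "(parity_conv e (companion_phi f) m has_vector_derivative (f x)\<^sup>2 * D) (at x within {0..b})"
    using companion_conv_deriv[OF x] .
  have fa: "((\<lambda>t. f t * a (Suc e) m t) has_vector_derivative f x * D + f' x * a (Suc e) m x)
      (at x within {0..b})"
    by (rule has_vector_derivative_mult[OF f_deriv[OF x] D(1)])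
  have "((\<lambda>t. f t * (f t * a (Suc e) m t) + parity_conv e (companion_phi f) m t)
      has_vector_derivative
      (f x * (f x * D + f' x * a (Suc e) m x) + f' x * (f x * a (Suc e) m x)) + (f x)\<^sup>2 * D)
      (at x within {0..b})"
    by (rule has_vector_derivative_add[OF has_vector_derivative_mult[OF f_deriv[OF x] fa] D(2)])
  moreover have "(\<lambda>t. f t * (f t * a (Suc e) m t) + parity_conv e (companion_phi f) m t) = B e m"
    by (simp add: fun_eq_iff B_def power2_eq_square)
  ultimately have "(B e m has_vector_derivative 2 * (f x * (f x * D + f' x * a (Suc e) m x)))
      (at x within {0..b})"
    by (simp add: algebra_simps power2_eq_square)
  then show thesis using that fa by blast
qed

lemma a_Suc_at_0: "a e (Suc m) 0 = 0"
  by (simp add: parity_conv_at_0 normalized_phi_at_0)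

lemma B_Suc_at_0: "B e (Suc m) 0 = 0"
  by (simp add: B_def parity_conv_at_0 normalized_phi_at_0 companion_phi_at_0)

section \<open>Recovering functions from their derivatives\<close>

lemma integral_eq_primitive:
  assumes G: "\<And>s. s \<in> {0..b} \<Longrightarrow> (G has_vector_derivative g s) (at s within {0..b})"
    and "G 0 = 0" and x: "x \<in> {0..b}"
    and h: "\<And>s. s \<in> {0..b} \<Longrightarrow> h s = g s"
  shows "integral {0..x} h = (G x :: complex)"
proof -
  have "(g has_integral G x - G 0) {0..x}"
    using x by (intro fundamental_theorem_of_calculus has_vector_derivative_within_subset[OF G]) auto
  then have "(h has_integral G x - G 0) {0..x}"
    by (rule has_integral_eq[rotated]) (use x h in auto)
  then show ?thesis
    using \<open>G 0 = 0\<close> by (simp add: integral_unique)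
qed

text \<open>
  Only the values of \<open>V\<close> on the interval enter, since the derivative is taken within it; this is what
  lets a formal power \<open>V\<close>, which an induction hypothesis describes on \<open>{0..b}\<close> only, be replaced
  by a convolution \<open>U\<close>.
\<close>

lemma differentiating_step_eq:
  assumes G: "\<And>s. s \<in> {0..b} \<Longrightarrow> \<exists>D.
      ((\<lambda>t. f t * U t) has_vector_derivative D) (at s within {0..b}) \<and>
      (G has_vector_derivative 2 * (f s * D)) (at s within {0..b})"
    and "G 0 = 0" and x: "x \<in> {0..b}"
    and V: "\<And>s. s \<in> {0..b} \<Longrightarrow> V s = U s"
  shows "2 * integral {0..x} (\<lambda>s. f s * vector_derivative (\<lambda>t. f t * V t) (at s within {0..b})) = G x"
proof -
  have "2 * (f s * vector_derivative (\<lambda>t. f t * V t) (at s within {0..b}))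
      = vector_derivative G (at s within {0..b})"
    and G': "(G has_vector_derivative vector_derivative G (at s within {0..b})) (at s within {0..b})"
    if s: "s \<in> {0..b}" for s
  proof -
    obtain D where D: "((\<lambda>t. f t * U t) has_vector_derivative D) (at s within {0..b})"
        "(G has_vector_derivative 2 * (f s * D)) (at s within {0..b})"
      using G[OF s] by blast
    have "((\<lambda>t. f t * V t) has_vector_derivative D) (at s within {0..b})"
      by (rule has_vector_derivative_transform[OF s _ D(1)]) (simp add: V)
    then show "2 * (f s * vector_derivative (\<lambda>t. f t * V t) (at s within {0..b}))
      = vector_derivative G (at s within {0..b})"
      by (simp only: vector_derivative_within_closed_interval[OF b_pos s, OF D(2)]
          vector_derivative_within_closed_interval[OF b_pos s])
    show "(G has_vector_derivative vector_derivative G (at s within {0..b})) (at s within {0..b})"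
      using D(2) vector_derivative_within_closed_interval[OF b_pos s D(2)] by simp
  qed
  then have "integral {0..x}
      (\<lambda>s. 2 * (f s * vector_derivative (\<lambda>t. f t * V t) (at s within {0..b}))) = G x"
    by (intro integral_eq_primitive[OF G' \<open>G 0 = 0\<close> x]) auto
  then show ?thesis by simp
qed

section \<open>The formal powers as convolutions\<close>

text \<open>
  The chain starts at \<open>B 0 0 = 1\<close>, not at a function \<open>a\<close>, so from \<open>Y\<^sup>(\<^sup>1\<^sup>)\<close> on every function in it
  vanishes at \<open>0\<close> and is the plain primitive of its derivative.
\<close>

lemma Y_eq_conv:
  shows "x \<in> {0..b} \<Longrightarrow> Y b f (2 * n) x = B n n x"
    and "x \<in> {0..b} \<Longrightarrow> Y b f (Suc (2 * n)) x = a n (Suc n) x"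
proof -
  have half: "Y b f (Suc (2 * n)) x = a n (Suc n) x"
    if "\<And>s. s \<in> {0..b} \<Longrightarrow> Y b f (2 * n) s = B n n s" and "x \<in> {0..b}" for n x
    using integral_eq_primitive[OF a_Suc_deriv a_Suc_at_0 that(2)] that(1) by simp
  have full: "\<forall>x\<in>{0..b}. Y b f (2 * n) x = B n n x" for n
  proof (induction n)
    case 0
    show ?case by (simp add: B_def parity_conv_0 companion_phi_def)
  next
    case (Suc n)
    have odd: "Y b f (Suc (2 * n)) s = a (Suc (Suc n)) (Suc n) s" if "s \<in> {0..b}" for s
      using half Suc.IH that by (simp add: parity_conv_add_2 del: Y.simps)
    have "Y b f (Suc (Suc (2 * n))) x = B (Suc n) (Suc n) x" if x: "x \<in> {0..b}" for x
      using differentiating_step_eq[of "a (Suc (Suc n)) (Suc n)" "B (Suc n) (Suc n)" x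
          "Y b f (Suc (2 * n))", OF _ B_Suc_at_0 x odd] B_deriv
      by (subst Y.simps(2)) (simp del: Y.simps, metis)
    then show ?case by (simp del: Y.simps)
  qed
  show "x \<in> {0..b} \<Longrightarrow> Y b f (2 * n) x = B n n x"
    using full by blast
  then show "x \<in> {0..b} \<Longrightarrow> Y b f (Suc (2 * n)) x = a n (Suc n) x"
    using half full by blast
qed

text \<open>
  The difference of the two parities obeys the same half-steps by linearity, but is \<open>1\<close> at index
  \<open>0\<close>, which is where the chain of \<open>Y_tilde\<close> starts.
\<close>

lemma Y_tilde_eq_conv_diff:
  "x \<in> {0..b} \<Longrightarrow> Y_tilde b f (2 * n) x = a n n x - a (Suc n) n x"
proof (induction n arbitrary: x)
  case 0
  show ?case by (simp add: parity_conv_0 normalized_phi_def)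
next
  case (Suc n)
  let ?E = "\<lambda>x. B (Suc n) n x - B n n x"
  have E0: "?E 0 = 0"
    \<comment> \<open>For \<open>n = 0\<close> neither term vanishes: the difference is \<open>f\<^sup>2 - 1\<close>, and \<open>f 0 = 1\<close> enters.\<close>
    by (cases n) (simp_all add: B_Suc_at_0,
        simp add: B_def parity_conv_0 normalized_phi_def companion_phi_def f_0)
  have E: "\<exists>D. ((\<lambda>t. f t * (a n n t - a (Suc n) n t)) has_vector_derivative D) (at s within {0..b}) \<and>
      (?E has_vector_derivative 2 * (f s * D)) (at s within {0..b})" if s: "s \<in> {0..b}" for s
  proof -
    obtain D1 where D1: "((\<lambda>t. f t * a (Suc (Suc n)) n t) has_vector_derivative D1) (at s within {0..b})"
        "(B (Suc n) n has_vector_derivative 2 * (f s * D1)) (at s within {0..b})"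
      using B_deriv[OF s] .
    obtain D2 where D2: "((\<lambda>t. f t * a (Suc n) n t) has_vector_derivative D2) (at s within {0..b})"
        "(B n n has_vector_derivative 2 * (f s * D2)) (at s within {0..b})"
      using B_deriv[OF s] .
    show ?thesis
      using has_vector_derivative_diff[OF D1(1) D2(1)] has_vector_derivative_diff[OF D1(2) D2(2)]
      by (intro exI[of _ "D1 - D2"]) (simp add: parity_conv_add_2 algebra_simps)
  qed
  have odd: "Y_tilde b f (Suc (2 * n)) s = ?E s" if s: "s \<in> {0..b}" for s
    using differentiating_step_eq[OF E E0 s Suc.IH] by simp
  have "((\<lambda>t. a (Suc n) (Suc n) t - a n (Suc n) t) has_vector_derivative ?E s / (f s)\<^sup>2)
      (at s within {0..b})" if s: "s \<in> {0..b}" for s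
    using has_vector_derivative_diff[OF a_Suc_deriv[OF s] a_Suc_deriv[OF s]]
    by (simp add: diff_divide_distrib)
  then have "integral {0..x} (\<lambda>s. Y_tilde b f (Suc (2 * n)) s / (f s)\<^sup>2)
      = a (Suc n) (Suc n) x - a n (Suc n) x"
    by (rule integral_eq_primitive[OF _ _ Suc.prems])
      (simp_all add: a_Suc_at_0 odd del: Y_tilde.simps)
  then show ?case
    by (simp add: parity_conv_add_2)
qed

end

theorem proposition3p4:
  fixes b :: real and q f :: "real \<Rightarrow> complex" and n :: nat
  assumes "b > 0"
    and "continuous_on {0..b} q"
    and "is_solution b q f"
    and "f 0 = 1"
    and "\<forall>x\<in>{0..b}. f x \<noteq> 0"
    and "n \<ge> 1"
  shows "(odd n \<longrightarrow> (\<forall>x\<in>{0..b}.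
            c_fun f n x / fact n = f x * Y b f (2 * n - 1) x \<and>
            s_fun f n x / fact n = f x * (Y_tilde b f (2 * n) x + Y b f (2 * n - 1) x))) \<and>
         (even n \<longrightarrow> (\<forall>x\<in>{0..b}.
            s_fun f n x / fact n = f x * Y b f (2 * n - 1) x \<and>
            c_fun f n x / fact n = f x * (Y_tilde b f (2 * n) x + Y b f (2 * n - 1) x)))"
proof -
  obtain f' where "\<And>x. x \<in> {0..b} \<Longrightarrow> (f has_vector_derivative f' x) (at x within {0..b})"
    using assms(3) unfolding is_solution_def by metis
  then interpret nonvanishing_differentiable b f f'
    using assms by unfold_locales auto
  obtain m where m: "n = Suc m"
    using assms(6) by (cases n) auto
  have Y: "Y b f (2 * n - 1) x = a (Suc n) n x"
    and sum: "Y_tilde b f (2 * n) x + Y b f (2 * n - 1) x = a n n x" if "x \<in> {0..b}" for x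
    using Y_eq_conv(2)[OF that, of m] Y_tilde_eq_conv_diff[OF that, of n]
    by (simp_all add: m parity_conv_add_2 del: Y.simps Y_tilde.simps)
  have parity: "a e n x = (if even e then a 0 n x else a 1 n x)" for e x
    by (simp add: parity_conv_def)
  show ?thesis
    using Y sum parity[of n] parity[of "Suc n"]
    by (auto simp only: c_fun_eq_parity_conv s_fun_eq_parity_conv even_Suc not_True_eq_False not_False_eq_True
        if_True if_False)
qed

end
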